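(* Let $n\geq2$, and let $v_{p-1}$ and $v_p$ be consecutive vectors within the child block in $\mathbb{V}(n)$ of a fixed parent in $\mathbb{V}(n-1)$, with canonical representatives $x_{p-1}$ and $x_p$. Suppose that $v_p$ is obtained from $v_{p-1}$ by one application of $(0~1)\mapsto(1~0)$ to the new terminal $1$ and ends in exactly $j\geq1$ zeros. Then $$x_p\equiv x_{p-1}\pmod{2^{\kappa(n)-j}}.$$ Let $\overline{3}_{n+1}$ be the multiplicative inverse of $3^{n+1}$ modulo $2^{\sigma_n}$. The difference $\Delta S=S(v_p)-S(v_{p-1})$ of the associated Diophantine sums is $$\Delta S=-2^{\kappa(n)-j}.$$ This yields the transition rule $$x_p\equiv x_{p-1}+\overline{3}_{n+1}\cdot 2^{\kappa(n)-j}\pmod{2^{\sigma_n}}.$$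
   Context: Let $\kappa(n)=\lfloor n\log_2 3\rfloor$ for $n\ge1$ and $\sigma_n=\lfloor 1+(n+1)\log_2 3\rfloor=\kappa(n+1)+1$. For $n\ge1$ let $\mathcal{A}_n$ be the set of integer vectors $\boldsymbol{\alpha}=(\alpha_1,\ldots,\alpha_{n+1})$ with $0=\alpha_1<\cdots<\alpha_{n+1}$ and $\alpha_{i+1}\le\kappa(i)$ for $1\le i\le n$. For $\boldsymbol{\alpha}\in\mathcal{A}_n$ let $v(\boldsymbol{\alpha})\in\{0,1\}^{\kappa(n)+1}$ be the vector (positions indexed $0,\ldots,\kappa(n)$) with ones precisely at positions $\alpha_1,\ldots,\alpha_{n+1}$, and $\mathbb{V}(n)=\{v(\boldsymbol{\alpha}):\boldsymbol{\alpha}\in\mathcal{A}_n\}$. For $v=v(\boldsymbol{\alpha})\in\mathbb{V}(n)$ the Diophantine sum is $S(v)=\sum_{i=1}^{n+1}3^{n+1-i}2^{\alpha_i}$. Let $T:\mathbb{Z}\to\mathbb{Z}$ be $T(x)=x/2$ for even $x$ and $T(x)=(3x+1)/2$ for odd $x$. The parity vector of length $L$ of an integer $x$ has entry $1$ at position $s$ ($0\le s\le L-1$) iff $T^s(x)$ is odd; it depends only on $x$ mod $2^L$ and gives a bijection $\mathbb{Z}/2^L\mathbb{Z}\to\{0,1\}^L$. The canonical representative of $v(\boldsymbol{\alpha})\in\mathbb{V}(n)$ is the unique $x\in\{1,\ldots,2^{\sigma_n}-1\}$ whose parity vector of length $\sigma_n$ has ones precisely at positions $\alpha_1,\ldots,\alpha_{n+1}$.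 For $n\ge2$, the child block of a parent $v(\alpha_1,\ldots,\alpha_n)\in\mathbb{V}(n-1)$ is the list of vectors $v(\alpha_1,\ldots,\alpha_n,a)\in\mathbb{V}(n)$ with $a$ decreasing from $\kappa(n)$ to $\alpha_n+1$; the $1$ at position $a$ is the new terminal $1$. Thus consecutive vectors in the block differ by moving the terminal $1$ one position to the left, and $v_p$ ends in exactly $j$ zeros when its terminal $1$ is at position $\kappa(n)-j$. *)

theory Defs
  imports Complex_Main "HOL-Number_Theory.Number_Theory"
begin

definition kappa :: "nat \<Rightarrow> nat" where
  "kappa n = nat \<lfloor>real n * log 2 3\<rfloor>"

definition sigma :: "nat \<Rightarrow> nat" where
  "sigma n = nat \<lfloor>1 + real (n + 1) * log 2 3\<rfloor>"

lemma sigma_eq: "sigma n = kappa (n + 1) + 1"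
proof -
  have "0 \<le> real (n + 1) * log 2 3" by simp
  hence "0 \<le> \<lfloor>real (n + 1) * log 2 3\<rfloor>" by (subst zero_le_floor)
  moreover have "\<lfloor>1 + real (n + 1) * log 2 3\<rfloor> = 1 + \<lfloor>real (n + 1) * log 2 3\<rfloor>"
    by linarith
  ultimately show ?thesis unfolding sigma_def kappa_def by linarith
qed

(* The vector (alpha_1, ..., alpha_(n+1)) is the list al with alpha_(i+1) = al ! i.
   Entries are natural numbers since alpha_1 = 0 and the vector is increasing. *)
definition admissible :: "nat \<Rightarrow> nat list set" where
  "admissible n = {al. length al = n + 1 \<and> al ! 0 = 0 \<and> sorted_wrt (<) al \<and>
     (\<forall>i\<in>{1..n}. al ! i \<le> kappa i)}"

(* 0/1 vectors are lists over {0, 1}; position k is the k-th list entry, counted from 0. *)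
definition vec_of :: "nat \<Rightarrow> nat list \<Rightarrow> nat list" where
  "vec_of n al = map (\<lambda>k. if k \<in> set al then 1 else 0) [0..<kappa n + 1]"

definition vecs :: "nat \<Rightarrow> nat list set" where
  "vecs n = vec_of n ` admissible n"

definition ones :: "nat list \<Rightarrow> nat list" where
  "ones v = filter (\<lambda>k. v ! k = 1) [0..<length v]"

lemma ones_vec_of:
  assumes "al \<in> admissible n"
  shows "ones (vec_of n al) = al"
proof -
  have len: "length al = n + 1" and z: "al ! 0 = 0" and srt: "sorted_wrt (<) al"
    and bd: "\<forall>i\<in>{1..n}. al ! i \<le> kappa i"
    using assms by (auto simp: admissible_def)
  have mono: "kappa i \<le> kappa n" if "i \<le> n" for i
    unfolding kappa_def using that by (intro nat_mono floor_mono mult_right_mono) auto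
  have le: "k < kappa n + 1" if "k \<in> set al" for k
  proof -
    obtain i where i: "i < n + 1" "k = al ! i"
      using \<open>k \<in> set al\<close> len by (auto simp: in_set_conv_nth)
    show ?thesis
    proof (cases "i = 0")
      case False
      with i have "i \<in> {1..n}" by simp
      with bd i have "k \<le> kappa i" by blast
      also have "\<dots> \<le> kappa n" using i by (intro mono) simp
      finally show ?thesis by simp
    qed (use i z in simp)
  qed
  have "ones (vec_of n al) = filter (\<lambda>k. k \<in> set al) [0..<kappa n + 1]"
    unfolding ones_def vec_of_def by (intro filter_cong) (auto simp del: upt_Suc)
  moreover have "set (filter (\<lambda>k. k \<in> set al) [0..<kappa n + 1]) = set al"
    using le by (auto simp del: upt_Suc)
  moreover have "sorted_wrt (<) (filter (\<lambda>k. k \<in> set al) [0..<kappa n + 1])"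
    by (intro sorted_wrt_filter) (simp del: upt_Suc)
  ultimately show ?thesis
    using srt strict_sorted_equal by metis
qed

definition dioph_sum :: "nat \<Rightarrow> nat list \<Rightarrow> int" where
  "dioph_sum n v = (\<Sum>i = 1..n + 1. 3 ^ (n + 1 - i) * 2 ^ (ones v ! (i - 1)))"

definition collatz_T :: "int \<Rightarrow> int" where
  "collatz_T x = (if even x then x div 2 else (3 * x + 1) div 2)"

definition parity_vector :: "nat \<Rightarrow> int \<Rightarrow> nat list" where
  "parity_vector L x = map (\<lambda>s. if odd ((collatz_T ^^ s) x) then 1 else 0) [0..<L]"

definition canonical_rep :: "nat \<Rightarrow> nat list \<Rightarrow> int" where
  "canonical_rep n v =
     (THE x. x \<in> {1..2 ^ sigma n - 1} \<and> ones (parity_vector (sigma n) x) = ones v)"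

(* u is the parent, an element of vecs (n - 1); last (ones u) is alpha_n. *)
definition child_block :: "nat \<Rightarrow> nat list \<Rightarrow> nat list list" where
  "child_block n u =
     map (\<lambda>a. vec_of n (ones u @ [a])) (rev [last (ones u) + 1..<kappa n + 1])"

(* Only zeros may follow the rewritten pair, so that its 1 is the terminal 1 of v. *)
definition terminal_shift :: "nat list \<Rightarrow> nat list \<Rightarrow> bool" where
  "terminal_shift v w \<longleftrightarrow>
     (\<exists>pre k. v = pre @ [0, 1] @ replicate k 0 \<and> w = pre @ [1, 0] @ replicate k 0)"

definition trailing_zeros :: "nat list \<Rightarrow> nat" where
  "trailing_zeros v = length (takeWhile (\<lambda>b. b = 0) (rev v))"

end

theory Submission
  imports Defs
begin

text \<open>
  Unrolling \<open>L\<close> steps of \<open>T\<close> gives \<open>2^L * T^L x = 3^m * x + S\<close>, where \<open>S\<close> is the Diophantine sum of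
  the \<open>m\<close> positions of the odd steps (\<open>affine_iterate\<close>). Two consequences carry the proof.
  First, equal parity vectors of length \<open>L\<close> force congruence modulo \<open>2^L\<close>. The \<open>2^L\<close> residues
  therefore have distinct parity vectors, and counting shows that every 0/1 vector of length \<open>L\<close>
  occurs (\<open>parity_vector_surj\<close>). This makes the canonical representative well defined.
  Second, with \<open>L = sigma n\<close> and \<open>m = n + 1\<close>, the canonical representative \<open>x\<close> of \<open>v\<close> solves
  \<open>3^(n + 1) * x + S(v) \<equiv> 0\<close> modulo \<open>2^sigma n\<close> (\<open>canonical_rep_dvd\<close>).

  Subtracting these congruences for two neighbours in a child block leaves
  \<open>3^(n + 1) * (x_p - x_(p-1)) \<equiv> - \<Delta>S\<close>. The rewriting step moves the last 1 from position
  \<open>a + 1\<close> to \<open>a = kappa n - j\<close>, and the last 1 carries the coefficient \<open>3^0\<close>, so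
  \<open>\<Delta>S = 2^a - 2^(a + 1) = - 2^a\<close>. Multiplying by the inverse of \<open>3^(n + 1)\<close> gives the transition
  rule, and reducing it modulo \<open>2^a\<close>, which divides \<open>2^sigma n\<close>, gives the first congruence.
\<close>

section \<open>Positions of ones and the Diophantine sum\<close>

lemma ones_append: "ones (xs @ ys) = ones xs @ map (\<lambda>k. k + length xs) (ones ys)"
proof -
  have "filter (\<lambda>k. (xs @ ys) ! k = 1) [0..<length xs] = ones xs"
    unfolding ones_def by (intro filter_cong) (auto simp: nth_append)
  moreover have "filter (\<lambda>k. (xs @ ys) ! k = 1) (map (\<lambda>k. k + length xs) [0..<length ys])
      = map (\<lambda>k. k + length xs) (ones ys)"
    unfolding ones_def filter_map
    by (intro arg_cong[where f = "map _"] filter_cong) (auto simp: nth_append)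
  moreover have "[0..<length (xs @ ys)] = [0..<length xs] @ map (\<lambda>k. k + length xs) [0..<length ys]"
    using upt_add_eq_append[of 0 "length xs" "length ys"] by (simp add: map_add_upt add.commute)
  ultimately show ?thesis
    unfolding ones_def[of "xs @ ys"] by simp
qed

lemma ones_replicate_zero [simp]: "ones (replicate k 0) = []"
  by (auto simp: ones_def filter_empty_conv)

lemma ones_Nil [simp]: "ones [] = []"
  by (simp add: ones_def)

lemma ones_Cons: "ones (b # v) = (if b = 1 then [0] else []) @ map Suc (ones v)"
  using ones_append[of "[b]" v] by (simp add: ones_def)

text \<open>The length \<open>L\<close> is a parameter because the parity vector of the canonical representative
  is longer than the vector it represents.\<close>
lemma ones_indicator:
  assumes "sorted_wrt (<) al" and "\<forall>k\<in>set al. k < L"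
  shows "ones (map (\<lambda>k. if k \<in> set al then 1 else 0) [0..<L]) = al"
proof -
  have "ones (map (\<lambda>k. if k \<in> set al then 1 else 0) [0..<L]) = filter (\<lambda>k. k \<in> set al) [0..<L]"
    unfolding ones_def by (intro filter_cong) auto
  moreover have "set (filter (\<lambda>k. k \<in> set al) [0..<L]) = set al"
    using assms(2) by auto
  moreover have "sorted_wrt (<) (filter (\<lambda>k. k \<in> set al) [0..<L])"
    by (intro sorted_wrt_filter) simp
  ultimately show ?thesis
    using assms(1) strict_sorted_equal by metis
qed

text \<open>The Diophantine sum in Horner form: one more odd step triples the sum and adds a power of 2,
  which is the shape in which it arises from iterating \<open>T\<close>. The reversal is due to the last position
  carrying the lowest power of 3.\<close>
definition odd_step_sum :: "nat list \<Rightarrow> int" where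
  "odd_step_sum al = horner_sum (\<lambda>a. 2 ^ a) 3 (rev al)"

lemma odd_step_sum_Nil [simp]: "odd_step_sum [] = 0"
  and odd_step_sum_snoc [simp]: "odd_step_sum (al @ [a]) = 3 * odd_step_sum al + 2 ^ a"
  by (simp_all add: odd_step_sum_def)

lemma dioph_sum_eq_odd_step_sum:
  assumes "length (ones v) = n + 1"
  shows "dioph_sum n v = odd_step_sum (ones v)"
  unfolding dioph_sum_def odd_step_sum_def horner_sum_eq_sum
  by (rule sum.reindex_bij_witness[of _ "\<lambda>k. n + 1 - k" "\<lambda>i. n + 1 - i"])
    (use assms in \<open>auto simp: rev_nth\<close>)

section \<open>Parity vectors\<close>

lemma length_parity_vector [simp]: "length (parity_vector L x) = L"
  by (simp add: parity_vector_def)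

lemma parity_vector_Suc:
  "parity_vector (Suc L) x = parity_vector L x @ [if odd ((collatz_T ^^ L) x) then 1 else 0]"
  by (simp add: parity_vector_def)

text \<open>The trajectory is an affine function of its start. An even step doubles the power of 2 on the
  left only; an odd step at time \<open>L\<close> triples both terms on the right and adds \<open>2^L\<close>.\<close>
lemma affine_iterate:
  "2 ^ L * (collatz_T ^^ L) x
     = 3 ^ length (ones (parity_vector L x)) * x + odd_step_sum (ones (parity_vector L x))"
proof (induction L)
  case 0
  show ?case by (simp add: parity_vector_def)
next
  case (Suc L)
  define y where "y = (collatz_T ^^ L) x"
  show ?case
  proof (cases "even y")
    case True
    then have "2 * collatz_T y = y" by (simp add: collatz_T_def)
    then have "2 ^ Suc L * collatz_T y = 2 ^ L * y" by (metis mult.assoc power_Suc2)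
    moreover have "ones (parity_vector (Suc L) x) = ones (parity_vector L x)"
      using True by (simp add: parity_vector_Suc ones_append ones_Cons flip: y_def)
    ultimately show ?thesis
      using Suc by (simp del: power_Suc flip: y_def)
  next
    case False
    then have "2 * collatz_T y = 3 * y + 1" unfolding collatz_T_def by presburger
    then have "2 ^ Suc L * collatz_T y = 2 ^ L * (3 * y + 1)" by (metis mult.assoc power_Suc2)
    also have "\<dots> = 3 * (2 ^ L * y) + 2 ^ L" by (simp add: algebra_simps)
    finally have "2 ^ Suc L * collatz_T y = 3 * (2 ^ L * y) + 2 ^ L" .
    moreover have "ones (parity_vector (Suc L) x) = ones (parity_vector L x) @ [L]"
      using False by (simp add: parity_vector_Suc ones_append ones_Cons flip: y_def)
    ultimately show ?thesis
      using Suc by (simp add: algebra_simps flip: y_def)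
  qed
qed

text \<open>Subtracting the two affine formulas leaves \<open>2^L\<close> dividing an odd multiple of \<open>x - y\<close>.\<close>
lemma cong_if_ones_parity_vector_eq:
  assumes "ones (parity_vector L x) = ones (parity_vector L y)"
  shows "[x = y] (mod 2 ^ L)"
proof -
  define m where "m = length (ones (parity_vector L y))"
  have "3 ^ m * (x - y) = 2 ^ L * ((collatz_T ^^ L) x - (collatz_T ^^ L) y)"
    using affine_iterate[of L x] affine_iterate[of L y] assms
    by (simp add: m_def right_diff_distrib)
  then have "2 ^ L dvd 3 ^ m * (x - y)" by simp
  moreover have "coprime (2 ^ L) ((3::int) ^ m)" by simp
  ultimately show ?thesis
    by (simp add: coprime_dvd_mult_right_iff cong_iff_dvd_diff)
qed

lemma ones_parity_vector_inj:
  assumes "x \<in> {0..<2 ^ L}" and "y \<in> {0..<2 ^ L}"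
    and "ones (parity_vector L x) = ones (parity_vector L y)"
  shows "x = y"
  using cong_if_ones_parity_vector_eq[OF assms(3)] assms(1,2) by (simp add: cong_def)

text \<open>Both sides have \<open>2^L\<close> elements, so injectivity already gives surjectivity.\<close>
lemma parity_vector_surj: "parity_vector L ` {0..<2 ^ L} = {w. set w \<subseteq> {0, 1} \<and> length w = L}"
proof (rule card_subset_eq)
  show "finite {w. set w \<subseteq> {0::nat, 1} \<and> length w = L}"
    by (rule finite_lists_length_eq) simp
  show "parity_vector L ` {0..<2 ^ L} \<subseteq> {w. set w \<subseteq> {0, 1} \<and> length w = L}"
    by (auto simp: parity_vector_def)
  have "inj_on (parity_vector L) {0..<2 ^ L}"
    by (intro inj_onI) (metis ones_parity_vector_inj)
  then have "card (parity_vector L ` {0..<2 ^ L}) = 2 ^ L"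
    by (simp add: card_image nat_power_eq)
  also have "\<dots> = card {w. set w \<subseteq> {0::nat, 1} \<and> length w = L}"
    using card_lists_length_eq[of "{0::nat, 1}" L] by (simp add: numeral_2_eq_2)
  finally show "card (parity_vector L ` {0..<2 ^ L}) = card {w. set w \<subseteq> {0::nat, 1} \<and> length w = L}" .
qed

lemma ones_parity_vector_zero: "ones (parity_vector L 0) = []"
proof -
  have "(collatz_T ^^ s) 0 = 0" for s
    by (induction s) (simp_all add: collatz_T_def)
  then show ?thesis
    by (simp add: parity_vector_def map_replicate_const)
qed

section \<open>Canonical representatives\<close>

lemma kappa_mono: "m \<le> n \<Longrightarrow> kappa m \<le> kappa n"
  unfolding kappa_def by (intro nat_mono floor_mono mult_right_mono) auto

lemma admissible_le_kappa:
  assumes "al \<in> admissible n" and "a \<in> set al"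
  shows "a \<le> kappa n"
proof -
  obtain i where i: "i \<le> n" "a = al ! i"
    using assms by (auto simp: in_set_conv_nth admissible_def less_Suc_eq_le)
  show ?thesis
  proof (cases "i = 0")
    case True
    then show ?thesis using assms(1) i by (simp add: admissible_def)
  next
    case False
    then have "a \<le> kappa i" using assms(1) i by (auto simp: admissible_def)
    then show ?thesis using kappa_mono[OF i(1)] by simp
  qed
qed

text \<open>The vectors considered contain a 1, which excludes the residue 0 and explains why
  the representative can be sought in \<open>{1..2^sigma n - 1}\<close>.\<close>
lemma ones_canonical_rep:
  assumes "v \<in> vecs n"
  shows "ones (parity_vector (sigma n) (canonical_rep n v)) = ones v"
proof -
  let ?L = "sigma n"
  obtain al where al: "al \<in> admissible n" "v = vec_of n al"
    using assms by (auto simp: vecs_def)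
  have "\<forall>k\<in>set al. k < ?L"
    using admissible_le_kappa[OF al(1)] kappa_mono[of n "n + 1"] by (fastforce simp: sigma_eq)
  then have ind: "ones (map (\<lambda>k. if k \<in> set al then 1 else 0) [0..<?L]) = ones v"
    using al by (simp add: ones_vec_of ones_indicator admissible_def)
  have "map (\<lambda>k. if k \<in> set al then 1 else 0) [0..<?L] \<in> parity_vector ?L ` {0..<2 ^ ?L}"
    unfolding parity_vector_surj by auto
  then obtain x where x: "x \<in> {0..<2 ^ ?L}" "ones (parity_vector ?L x) = ones v"
    using ind by (metis imageE)
  have "ones v \<noteq> []"
    using al by (auto simp: ones_vec_of admissible_def)
  then have "x \<noteq> 0"
    using x(2) by (metis ones_parity_vector_zero)
  then have "x \<in> {1..2 ^ ?L - 1} \<and> ones (parity_vector ?L x) = ones v"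
    using x by auto
  then have "canonical_rep n v \<in> {1..2 ^ ?L - 1}
      \<and> ones (parity_vector ?L (canonical_rep n v)) = ones v"
    unfolding canonical_rep_def
  proof (rule theI)
    fix y assume "y \<in> {1..2 ^ ?L - 1} \<and> ones (parity_vector ?L y) = ones v"
    then show "y = x"
      using x by (intro ones_parity_vector_inj[of _ ?L]) auto
  qed
  then show ?thesis by simp
qed

lemma length_ones_vecs: "v \<in> vecs n \<Longrightarrow> length (ones v) = n + 1"
  by (auto simp: vecs_def ones_vec_of admissible_def)

text \<open>The affine formula at \<open>L = sigma n\<close>: its left-hand side is a multiple of \<open>2^sigma n\<close>.\<close>
lemma canonical_rep_dvd:
  assumes "v \<in> vecs n"
  shows "2 ^ sigma n dvd 3 ^ (n + 1) * canonical_rep n v + dioph_sum n v"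
proof -
  have "3 ^ (n + 1) * canonical_rep n v + dioph_sum n v
      = 2 ^ sigma n * (collatz_T ^^ sigma n) (canonical_rep n v)"
    using affine_iterate[of "sigma n" "canonical_rep n v"] assms
    by (simp add: ones_canonical_rep length_ones_vecs dioph_sum_eq_odd_step_sum)
  then show ?thesis by simp
qed

section \<open>Child blocks and the terminal shift\<close>

lemma child_block_subset_vecs:
  assumes "n \<ge> 1" and "u \<in> vecs (n - 1)"
  shows "set (child_block n u) \<subseteq> vecs n"
proof
  fix v assume "v \<in> set (child_block n u)"
  then obtain a where "a \<in> set [last (ones u) + 1..<kappa n + 1]" and v: "v = vec_of n (ones u @ [a])"
    by (auto simp: child_block_def simp del: upt_Suc)
  then have a: "last (ones u) < a" "a \<le> kappa n"
    by auto
  have al: "ones u \<in> admissible (n - 1)"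
    using assms(2) by (auto simp: vecs_def ones_vec_of)
  then have len: "length (ones u) = n"
    using assms(1) by (simp add: admissible_def)
  have "k < a" if "k \<in> set (ones u)" for k
  proof -
    have "ones u \<noteq> []"
      using len assms(1) by auto
    then have snoc: "ones u = butlast (ones u) @ [last (ones u)]"
      by simp
    have "sorted_wrt (<) (ones u)"
      using al by (simp add: admissible_def)
    then have "\<forall>i\<in>set (butlast (ones u)). i < last (ones u)"
      by (subst (asm) snoc) (simp add: sorted_wrt_append)
    moreover have "k \<in> set (butlast (ones u)) \<or> k = last (ones u)"
      using that by (subst (asm) snoc) auto
    ultimately have "k \<le> last (ones u)" by auto
    then show ?thesis using a(1) by simp
  qed
  then have "ones u @ [a] \<in> admissible n"
    using al a(2) len assms(1)
    by (auto simp: admissible_def sorted_wrt_append nth_append)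
  then show "v \<in> vecs n"
    using v by (simp add: vecs_def)
qed

lemma trailing_zeros_one_replicate: "trailing_zeros (pre @ [1] @ replicate k 0) = k"
  by (simp add: trailing_zeros_def takeWhile_append)

text \<open>The position of the shifted 1 can be read off in two ways: as the length of the common prefix
  and, counting from the right end of a vector of length \<open>kappa n + 1\<close>, as \<open>kappa n - j\<close>.\<close>
lemma dioph_sum_terminal_shift:
  assumes "v' \<in> vecs n" and "v \<in> vecs n" and "terminal_shift v' v"
  shows "dioph_sum n v - dioph_sum n v' = - (2 ^ (kappa n - trailing_zeros v))"
proof -
  obtain pre k where v': "v' = pre @ [0, 1] @ replicate k 0"
    and v: "v = pre @ [1, 0] @ replicate k 0"
    using assms(3) unfolding terminal_shift_def by blast
  have "length v = kappa n + 1"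
    using assms(2) by (auto simp: vecs_def vec_of_def)
  moreover have "trailing_zeros v = k + 1"
    using trailing_zeros_one_replicate[of pre "k + 1"] by (simp add: v)
  ultimately have "kappa n - trailing_zeros v = length pre"
    by (simp add: v)
  moreover have "ones v = ones pre @ [length pre]" "ones v' = ones pre @ [length pre + 1]"
    by (simp_all add: v v' ones_append ones_Cons)
  moreover have "dioph_sum n v = odd_step_sum (ones v)" "dioph_sum n v' = odd_step_sum (ones v')"
    using assms(1,2) by (simp_all only: dioph_sum_eq_odd_step_sum length_ones_vecs)
  ultimately show ?thesis by simp
qed

theorem corollary21:
  fixes n p j :: nat and u v v' :: "nat list"
  assumes "n \<ge> 2"
    and "u \<in> vecs (n - 1)"
    and "1 \<le> p" and "p < length (child_block n u)"
    and "v' = child_block n u ! (p - 1)"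
    and "v = child_block n u ! p"
    and "terminal_shift v' v"
    and "trailing_zeros v = j" and "j \<ge> 1"
  shows "[canonical_rep n v = canonical_rep n v'] (mod 2 ^ (kappa n - j))
    \<and> dioph_sum n v - dioph_sum n v' = - (2 ^ (kappa n - j))
    \<and> [canonical_rep n v = canonical_rep n v'
         + modular_inverse (2 ^ sigma n) (3 ^ (n + 1)) * 2 ^ (kappa n - j)] (mod 2 ^ sigma n)"
proof -
  let ?x = "canonical_rep n v" and ?x' = "canonical_rep n v'"
  let ?M = "2 ^ sigma n :: int" and ?t = "3 ^ (n + 1) :: int" and ?d = "2 ^ (kappa n - j) :: int"
  let ?i = "modular_inverse ?M ?t"
  have "set (child_block n u) \<subseteq> vecs n"
    using assms(1,2) by (intro child_block_subset_vecs) auto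
  moreover have "v \<in> set (child_block n u)" "v' \<in> set (child_block n u)"
    using assms(3-6) by simp_all
  ultimately have V: "v \<in> vecs n" "v' \<in> vecs n"
    by auto
  have dS: "dioph_sum n v - dioph_sum n v' = - ?d"
    using dioph_sum_terminal_shift[OF V(2,1) assms(7)] assms(8) by simp
  have "?M dvd (?t * ?x + dioph_sum n v) - (?t * ?x' + dioph_sum n v')"
    using V by (intro dvd_diff canonical_rep_dvd)
  also have "(?t * ?x + dioph_sum n v) - (?t * ?x' + dioph_sum n v') = ?t * (?x - ?x') - ?d"
    using dS by (simp add: algebra_simps)
  finally have "[?t * (?x - ?x') = ?d] (mod ?M)"
    by (simp add: cong_iff_dvd_diff)
  then have "[?i * ?t * (?x - ?x') = ?i * ?d] (mod ?M)"
    unfolding mult.assoc by (rule cong_scalar_left)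
  moreover have "[?i * ?t * (?x - ?x') = 1 * (?x - ?x')] (mod ?M)"
    by (intro cong_scalar_right cong_modular_inverse2) simp
  ultimately have "[1 * (?x - ?x') = ?i * ?d] (mod ?M)"
    by (blast intro: cong_sym cong_trans)
  then have rule: "[?x = ?x' + ?i * ?d] (mod ?M)"
    by (simp add: cong_iff_dvd_diff algebra_simps)
  have "kappa n - j \<le> sigma n"
    using kappa_mono[of n "n + 1"] by (simp add: sigma_eq)
  then have "?d dvd ?M"
    by (rule le_imp_power_dvd)
  with rule have "[?x = ?x' + ?i * ?d] (mod ?d)"
    by (rule cong_dvd_modulus)
  then have "[?x = ?x'] (mod ?d)"
    by (simp add: cong_def)
  with dS rule show ?thesis by blast
qed

end
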